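(* Let $u$ be the state space of an event system with conjunctive set transformer $S:\mathcal{P}(u)\to\mathcal{P}(u)$ (the choice of its events) and set of initial states $\mathit{init}\subseteq u$, and let $\mathit{si}\subseteq u$ be the set of states satisfying its strongest invariant, i.e. the smallest set $X\subseteq u$ with $\mathit{init}\subseteq X$ and $X\subseteq S(X)$. Let $W:\mathcal{P}(u)\to\mathcal{P}(u)$ be a monotonic and strict ($W(\varnothing)=\varnothing$) set transformer, and for $r\subseteq u$ let $\mathcal{F}(r)(x)=r\cup W(x)$, with least fixpoint $\mathrm{fix}(\mathcal{F}(r))$. Define $$\mathcal{T}=\{(a,b)\mid a\subseteq u,\ b\subseteq u,\ \mathit{si}\cap a\subseteq\mathrm{fix}(\mathcal{F}(\mathit{si}\cap b))\}.$$ Let $\mathcal{E}\subseteq\mathcal{P}(u)\times\mathcal{P}(u)$ and let $\mathcal{L}$ be the smallest relation on $\mathcal{P}(u)$ containing $\mathcal{E}$, transitive (if $(a,c),(c,b)\in\mathcal{L}$ then $(a,b)\in\mathcal{L}$), and disjunctive (for every $q\subseteq u$ and family $l\subseteq\mathcal{P}(u)$ with $(p,q)\in\mathcal{L}$ for all $p\in l$, $(\bigcup l,q)\in\mathcal{L}$). Assume that for all $a,b,r\subseteq u$: (a) if $(a,b)\in\mathcal{E}$ then $\mathit{si}\cap a\cap\overline{b}\subseteq W(\mathit{si}\cap b)$; (b) if $a\subseteq b$ then $(a,b)\in\mathcal{E}$; (c) if $\mathit{si}\cap a\subseteq b$ then $(a,b)\in\mathcal{E}$; (d) $(W(r),r)\in\mathcal{L}$.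 Then $\mathcal{L}=\mathcal{T}$.
   Context: A set transformer on $u$ is a total function $\mathcal{P}(u)\to\mathcal{P}(u)$; conjunctive means it distributes over nonempty intersections. $\overline{p}=u\setminus p$. *)

theory Defs
  imports Main "HOL-Library.FuncSet"
begin

text \<open>The state space \<open>u\<close> is an arbitrary set, so that it may be empty. Set transformers are functions
  on \<open>'a set\<close> that map \<open>Pow u\<close> into \<open>Pow u\<close>; their values outside \<open>Pow u\<close> are irrelevant, and every
  notion below only quantifies over subsets of \<open>u\<close>.\<close>

definition conjunctive_on :: "'a set \<Rightarrow> ('a set \<Rightarrow> 'a set) \<Rightarrow> bool" where
  "conjunctive_on u S \<longleftrightarrow>
     (\<forall>A. A \<subseteq> Pow u \<and> A \<noteq> {} \<longrightarrow> S (\<Inter>A) = (\<Inter>X\<in>A. S X))"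

text \<open>This is a predicate rather than a function because the smallest invariant need not exist when
  \<open>S u \<noteq> u\<close>.\<close>

definition is_strongest_invariant ::
    "'a set \<Rightarrow> ('a set \<Rightarrow> 'a set) \<Rightarrow> 'a set \<Rightarrow> 'a set \<Rightarrow> bool" where
  "is_strongest_invariant u S init si \<longleftrightarrow>
     si \<subseteq> u \<and> init \<subseteq> si \<and> si \<subseteq> S si \<and>
     (\<forall>X. X \<subseteq> u \<and> init \<subseteq> X \<and> X \<subseteq> S X \<longrightarrow> si \<subseteq> X)"

text \<open>The least fixpoint is taken in \<open>Pow u\<close>. The constant \<^const>\<open>lfp\<close> would also range over sets that
  are not subsets of \<open>u\<close>, where \<open>f\<close> is unconstrained.\<close>

definition fix_on :: "'a set \<Rightarrow> ('a set \<Rightarrow> 'a set) \<Rightarrow> 'a set" where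
  "fix_on u f = (LEAST x. x \<subseteq> u \<and> f x = x)"

definition F_trans :: "('a set \<Rightarrow> 'a set) \<Rightarrow> 'a set \<Rightarrow> 'a set \<Rightarrow> 'a set" where
  "F_trans W r x = r \<union> W x"

definition T_rel :: "'a set \<Rightarrow> ('a set \<Rightarrow> 'a set) \<Rightarrow> 'a set \<Rightarrow> ('a set \<times> 'a set) set" where
  "T_rel u W si =
     {(a, b). a \<subseteq> u \<and> b \<subseteq> u \<and> si \<inter> a \<subseteq> fix_on u (F_trans W (si \<inter> b))}"

text \<open>In the disjunction rule the family \<open>l\<close> may be empty.\<close>

inductive_set L_rel :: "'a set \<Rightarrow> ('a set \<times> 'a set) set \<Rightarrow> ('a set \<times> 'a set) set"
  for u :: "'a set" and E :: "('a set \<times> 'a set) set" where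
  base: "(a, b) \<in> E \<Longrightarrow> (a, b) \<in> L_rel u E"
| trans: "(a, c) \<in> L_rel u E \<Longrightarrow> (c, b) \<in> L_rel u E \<Longrightarrow> (a, b) \<in> L_rel u E"
| disj: "q \<subseteq> u \<Longrightarrow> l \<subseteq> Pow u \<Longrightarrow> \<forall>p\<in>l. (p, q) \<in> L_rel u E \<Longrightarrow> (\<Union>l, q) \<in> L_rel u E"

lemma fix_on_least:
  assumes f: "f \<in> Pow u \<rightarrow> Pow u" and m: "mono_on (Pow u) f"
  shows fix_on_subset: "fix_on u f \<subseteq> u"
    and fix_on_unfold: "f (fix_on u f) = fix_on u f"
    and fix_on_lowerbound: "\<And>x. x \<subseteq> u \<Longrightarrow> f x \<subseteq> x \<Longrightarrow> fix_on u f \<subseteq> x"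
proof -
  define z where "z = \<Inter>{x. x \<subseteq> u \<and> f x \<subseteq> x}"
  have sub: "f x \<subseteq> u" if "x \<subseteq> u" for x using f that by auto
  have mon: "f x \<subseteq> f y" if "x \<subseteq> y" "y \<subseteq> u" for x y
    using m that by (meson PowI mono_onD order_trans)
  have low: "z \<subseteq> x" if "x \<subseteq> u" "f x \<subseteq> x" for x using that unfolding z_def by blast
  have zu: "z \<subseteq> u" using low[of u] sub[of u] by simp
  have fz: "f z \<subseteq> z"
    unfolding z_def
  proof (intro Inter_greatest)
    fix x assume "x \<in> {x. x \<subseteq> u \<and> f x \<subseteq> x}"
    then have "x \<subseteq> u" "f x \<subseteq> x" by auto
    then show "f (\<Inter>{x. x \<subseteq> u \<and> f x \<subseteq> x}) \<subseteq> x"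
      using mon[of z x] low[of x] unfolding z_def by blast
  qed
  have eq: "f z = z"
    using fz low[of "f z"] mon[OF fz zu] sub[OF zu] by blast
  have "fix_on u f = z"
    unfolding fix_on_def using zu eq low by (intro Least_equality) auto
  then show "fix_on u f \<subseteq> u" "f (fix_on u f) = fix_on u f"
    "\<And>x. x \<subseteq> u \<Longrightarrow> f x \<subseteq> x \<Longrightarrow> fix_on u f \<subseteq> x"
    using zu eq low by auto
qed

end

theory Submission
  imports Defs
begin

text \<open>Soundness is an induction on the derivation: each fixpoint of \<open>F_trans W r\<close> is closed under \<open>W\<close>,
  which yields transitivity. For completeness, disjunctivity provides a largest \<open>X\<close> with
  \<open>(X, r) \<in> L_rel u E\<close>. Since \<open>X\<close> contains \<open>r\<close> and, by transitivity with \<open>(W X, X)\<close>, also \<open>W X\<close>, it is a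
  prefixpoint of \<open>F_trans W r\<close> and therefore contains the least fixpoint.\<close>

lemma
  assumes W: "W \<in> Pow u \<rightarrow> Pow u" and m: "mono_on (Pow u) W" and r: "r \<subseteq> u"
  shows fix_F_trans_subset: "fix_on u (F_trans W r) \<subseteq> u"
    and fix_F_trans_unfold: "r \<union> W (fix_on u (F_trans W r)) = fix_on u (F_trans W r)"
    and fix_F_trans_lowerbound: "\<And>x. x \<subseteq> u \<Longrightarrow> r \<union> W x \<subseteq> x \<Longrightarrow> fix_on u (F_trans W r) \<subseteq> x"
proof -
  have F: "F_trans W r \<in> Pow u \<rightarrow> Pow u"
    using W r unfolding F_trans_def by auto
  have mF: "mono_on (Pow u) (F_trans W r)"
    unfolding F_trans_def by (intro mono_onI Un_mono order_refl mono_onD[OF m])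
  show "fix_on u (F_trans W r) \<subseteq> u"
    by (rule fix_on_subset[OF F mF])
  show "r \<union> W (fix_on u (F_trans W r)) = fix_on u (F_trans W r)"
    using fix_on_unfold[OF F mF] by (simp only: F_trans_def)
  show "fix_on u (F_trans W r) \<subseteq> x" if "x \<subseteq> u" "r \<union> W x \<subseteq> x" for x
    using fix_on_lowerbound[OF F mF, of x] that by (simp only: F_trans_def)
qed

text \<open>\<open>T_rel\<close> only bounds \<open>si \<inter> a\<close> from above by a set that
  depends on the second component, so each rule of \<open>L_rel\<close> reduces to comparing such
  bounds.\<close>

lemma L_rel_subset_T_rel:
  assumes W: "W \<in> Pow u \<rightarrow> Pow u" and m: "mono_on (Pow u) W"
    and E_sub: "E \<subseteq> Pow u \<times> Pow u"
    and E_step: "\<And>a b. (a, b) \<in> E \<Longrightarrow> si \<inter> a \<inter> (u - b) \<subseteq> W (si \<inter> b)"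
  shows "L_rel u E \<subseteq> T_rel u W si"
proof (rule subrelI)
  note fix_sub = fix_F_trans_subset[OF W m]
    and unfold = fix_F_trans_unfold[OF W m]
    and lowerbound = fix_F_trans_lowerbound[OF W m]
  fix p q assume "(p, q) \<in> L_rel u E"
  then show "(p, q) \<in> T_rel u W si"
  proof induction
    case (base a b)
    define Z where "Z = fix_on u (F_trans W (si \<inter> b))"
    have ab: "a \<subseteq> u" "b \<subseteq> u" using base E_sub by auto
    then have r: "si \<inter> b \<subseteq> u" by blast
    have Z: "si \<inter> b \<union> W Z = Z" "Z \<subseteq> u"
      using unfold[OF r] fix_sub[OF r] by (simp_all add: Z_def)
    \<comment> \<open>States of \<open>si \<inter> a\<close> inside \<open>b\<close> lie in
      \<open>Z\<close> directly; those outside \<open>b\<close> lie in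
      \<open>W (si \<inter> b)\<close> by \<open>E_step\<close>, hence in \<open>W Z\<close>, which
      is part of \<open>Z\<close>.\<close>
    have "W (si \<inter> b) \<subseteq> W Z"
      using Z r by (intro mono_onD[OF m]) auto
    then have "si \<inter> a \<subseteq> Z"
      using E_step[OF base] Z ab by blast
    then show ?case
      using ab by (simp add: T_rel_def Z_def)
  next
    case (trans a c b)
    define Z where "Z = fix_on u (F_trans W (si \<inter> b))"
    have ab: "a \<subseteq> u" "b \<subseteq> u" "c \<subseteq> u"
      and ac: "si \<inter> a \<subseteq> fix_on u (F_trans W (si \<inter> c))" and cb: "si \<inter> c \<subseteq> Z"
      using trans.IH by (auto simp: T_rel_def Z_def)
    have r: "si \<inter> b \<subseteq> u" "si \<inter> c \<subseteq> u" using ab by blast+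
    have Z: "si \<inter> b \<union> W Z = Z" "Z \<subseteq> u"
      using unfold[OF r(1)] fix_sub[OF r(1)] by (simp_all add: Z_def)
    \<comment> \<open>\<open>Z\<close> contains both \<open>si \<inter> c\<close> and
      \<open>W Z\<close>, so it is a prefixpoint for the target \<open>c\<close> as well.\<close>
    have "fix_on u (F_trans W (si \<inter> c)) \<subseteq> Z"
      using Z cb by (intro lowerbound[OF r(2)]) blast+
    then show ?case
      using ab ac by (simp add: T_rel_def Z_def)
  next
    case (disj q l)
    \<comment> \<open>All members of \<open>l\<close> share the bound given by \<open>q\<close>, so
      their union obeys it too.\<close>
    then show ?case by (fastforce simp: T_rel_def)
  qed
qed

text \<open>Taking the union of all sets related to \<open>r\<close> at once replaces a transfinite
  iteration of \<open>F_trans W r\<close> from the empty set.\<close>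

lemma fix_F_trans_L_rel:
  assumes W: "W \<in> Pow u \<rightarrow> Pow u" and m: "mono_on (Pow u) W"
    and E_incl: "\<And>a b. b \<subseteq> u \<Longrightarrow> a \<subseteq> b \<Longrightarrow> (a, b) \<in> E"
    and W_L: "\<And>r. r \<subseteq> u \<Longrightarrow> (W r, r) \<in> L_rel u E"
    and r: "r \<subseteq> u"
  shows "(fix_on u (F_trans W r), r) \<in> L_rel u E"
proof -
  define X where "X = \<Union>{p. p \<subseteq> u \<and> (p, r) \<in> L_rel u E}"
  have Xu: "X \<subseteq> u" by (auto simp: X_def)
  have X: "(X, r) \<in> L_rel u E"
    unfolding X_def using r by (intro L_rel.disj) auto
  \<comment> \<open>\<open>W_L\<close> is used at \<open>X\<close> rather than at \<open>r\<close>: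
    one more step of \<open>W\<close> before \<open>X\<close> still leads to \<open>r\<close>, so
    maximality of \<open>X\<close> absorbs it.\<close>
  have "(W X, r) \<in> L_rel u E"
    using W_L[OF Xu] X by (rule L_rel.trans)
  then have "W X \<subseteq> X"
    using W Xu by (auto simp: X_def)
  moreover have "r \<subseteq> X"
    using r L_rel.base[OF E_incl[OF r order_refl]] by (auto simp: X_def)
  ultimately have "fix_on u (F_trans W r) \<subseteq> X"
    using Xu by (intro fix_F_trans_lowerbound[OF W m r]) auto
  then show ?thesis
    using X Xu by (blast intro: L_rel.trans L_rel.base E_incl)
qed

theorem theorem4:
  fixes u init si :: "'a set"
    and S W :: "'a set \<Rightarrow> 'a set"
    and E :: "('a set \<times> 'a set) set"
  assumes S_trans: "S \<in> Pow u \<rightarrow> Pow u"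
    and S_conj: "conjunctive_on u S"
    and init_sub: "init \<subseteq> u"
    and si: "is_strongest_invariant u S init si"
    and W_trans: "W \<in> Pow u \<rightarrow> Pow u"
    and W_mono: "mono_on (Pow u) W"
    and W_strict: "W {} = {}"
    and E_sub: "E \<subseteq> Pow u \<times> Pow u"
    and a: "\<And>a b. a \<subseteq> u \<Longrightarrow> b \<subseteq> u \<Longrightarrow> (a, b) \<in> E \<Longrightarrow> si \<inter> a \<inter> (u - b) \<subseteq> W (si \<inter> b)"
    and b: "\<And>a b. a \<subseteq> u \<Longrightarrow> b \<subseteq> u \<Longrightarrow> a \<subseteq> b \<Longrightarrow> (a, b) \<in> E"
    and c: "\<And>a b. a \<subseteq> u \<Longrightarrow> b \<subseteq> u \<Longrightarrow> si \<inter> a \<subseteq> b \<Longrightarrow> (a, b) \<in> E"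
    and d: "\<And>r. r \<subseteq> u \<Longrightarrow> (W r, r) \<in> L_rel u E"
  shows "L_rel u E = T_rel u W si"
proof
  show "L_rel u E \<subseteq> T_rel u W si"
    by (rule L_rel_subset_T_rel[OF W_trans W_mono E_sub]) (use a E_sub in blast)
  show "T_rel u W si \<subseteq> L_rel u E"
  proof (rule subrelI)
    fix p q assume "(p, q) \<in> T_rel u W si"
    define Z where "Z = fix_on u (F_trans W (si \<inter> q))"
    have pq: "p \<subseteq> u" "q \<subseteq> u" "si \<inter> p \<subseteq> Z"
      using \<open>(p, q) \<in> T_rel u W si\<close> by (auto simp: T_rel_def Z_def)
    have r: "si \<inter> q \<subseteq> u" using pq by blast
    have "Z \<subseteq> u"
      unfolding Z_def by (rule fix_F_trans_subset[OF W_trans W_mono r])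
    \<comment> \<open>The chain runs from \<open>p\<close> through \<open>Z\<close> and
      \<open>si \<inter> q\<close> to \<open>q\<close>. Assumption \<open>c\<close> is what allows
      the states of \<open>p\<close> outside \<open>si\<close> to be ignored, since only
      \<open>si \<inter> p\<close> is known to lie in \<open>Z\<close>.\<close>
    then have "(p, Z) \<in> L_rel u E"
      using pq by (intro L_rel.base c)
    also have "(Z, si \<inter> q) \<in> L_rel u E"
      unfolding Z_def using b d by (intro fix_F_trans_L_rel[OF W_trans W_mono _ _ r]) auto
    also (L_rel.trans) have "(si \<inter> q, q) \<in> L_rel u E"
      using pq r by (intro L_rel.base b) auto
    finally (L_rel.trans) show "(p, q) \<in> L_rel u E" .
  qed
qed

end
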